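(* Minimal lift maps define an inclusion-exclusion structure on reduced words. That is, for every $n\geq 0$ and $w\in S_n$, the minimal lift maps $\iota_I\colon\mathrm{RW}(w|_I)\to\mathrm{RW}(w)$, $I\subseteq[1,n]$, are injective, and for all $I,J\subseteq[1,n]$, $$\iota_{I\cap J}(\mathrm{RW}(w|_{I\cap J}))=\iota_I(\mathrm{RW}(w|_I))\cap\iota_J(\mathrm{RW}(w|_J)).$$
   Context: $S_n$ is the set of permutations of $[1,n]=\{1,\dots,n\}$ (with $S_0=\{\varnothing\}$). For $w\in S_n$ and $I=\{a_1<\dots<a_h\}\subseteq[1,n]$, $w|_I\in S_h$ is the permutation whose entries are in the same relative order as $w(a_1)\cdots w(a_h)$. A reduced word for $w\in S_n$ is an expression $w=s_{i_\ell}\cdots s_{i_1}$ of minimal length as a product of adjacent transpositions, where $s_i$ exchanges $i$ and $i+1$ and products are function compositions (read right to left); $\mathrm{RW}(w)$ is the set of reduced words of $w$. An inversion of $w$ is a pair of indices $a<b$ with $w(a)>w(b)$. The letter $s_{i_k}$ in a reduced word $s_{i_\ell}\cdots s_{i_1}$ creates the inversion $(a,b)$ if $(a,b)$ is an inversion of $s_{i_k}\cdots s_{i_1}$ but not of $s_{i_{k-1}}\cdots s_{i_1}$; explicitly, $s_{i_{k-1}}\cdots s_{i_1}(a)=i_k$ and $s_{i_{k-1}}\cdots s_{i_1}(b)=i_k+1$. Thus a reduced word of $w$ is determined by the order in which it creates the inversions of $w$. For $I\subseteq[1,n]$, the restriction map $\pi=\pi_I\colon\mathrm{RW}(w)\to\mathrm{RW}(w|_I)$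 records only the inversions between indices in $I$, in the order in which they are created: a letter $s_{i_k}$ creating $(a,b)$ is deleted unless $a,b\in I$, in which case it is replaced by $s_j$ with $j=\#\{c\in I: s_{i_{k-1}}\cdots s_{i_1}(c)\le i_k\}$ (in terms of wiring diagrams, the wires starting outside $I$ are removed). These maps are surjective. The minimal lift of $x\in\mathrm{RW}(w|_I)$ to $w$ is the reduced word $\iota_I(x)=s_{i_\ell}\cdots s_{i_1}\in\pi_I^{-1}(x)$ whose index sequence $(i_1,\dots,i_\ell)$ (read from the right end of the word) is lexicographically minimal among all elements of $\pi_I^{-1}(x)$. An inclusion-exclusion structure for a family of finite sets $\mathrm{Set}(w)$ indexed by permutations is a family of injections $\mathrm{Set}(w|_I)\hookrightarrow\mathrm{Set}(w)$, for all $w\in S_n$ and $I\subseteq[1,n]$, such that inside $\mathrm{Set}(w)$ the image of $\mathrm{Set}(w|_{I\cap J})$ is the intersection of the images of $\mathrm{Set}(w|_I)$ and $\mathrm{Set}(w|_J)$ for all $I,J\subseteq[1,n]$. *)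

theory Defs
  imports "HOL-Combinatorics.Permutations" "HOL-Library.List_Lexorder"
begin

text \<open>
  A permutation in \<open>S\<^sub>n\<close> is a function \<open>w :: nat \<Rightarrow> nat\<close> with \<open>w permutes {1..n}\<close>. As such a function
  does not determine \<open>n\<close>, the size is passed along as a separate argument.
\<close>

text \<open>
  The entry of \<open>w|\<^sub>I\<close> at position \<open>j\<close> is the rank of \<open>w a\<^sub>j\<close> in \<open>w ` I\<close>, where
  \<open>I = {a\<^sub>1 < ... < a\<^sub>h}\<close>; beyond \<open>{1..h}\<close> it is the identity, as \<open>permutes\<close> requires.
  The lemmas below show that this is the unique permutation in \<open>S\<^sub>h\<close> with the relative order of
  \<open>w a\<^sub>1 ... w a\<^sub>h\<close>.
\<close>

definition elem_at :: "nat set \<Rightarrow> nat \<Rightarrow> nat" where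
  "elem_at I j = sorted_list_of_set I ! (j - 1)"

definition pattern :: "(nat \<Rightarrow> nat) \<Rightarrow> nat set \<Rightarrow> nat \<Rightarrow> nat" where
  "pattern w I j = (if j \<in> {1..card I} then card {c \<in> I. w c \<le> w (elem_at I j)} else j)"

lemma elem_at_bij:
  assumes "finite I"
  shows "bij_betw (elem_at I) {1..card I} I"
proof -
  have "bij_betw (nth (sorted_list_of_set I)) {..<card I} I"
    using assms by (intro bij_betw_nth) auto
  moreover have "bij_betw (\<lambda>j. j - 1) {1..card I} {..<card I}"
    by (rule bij_betw_byWitness[of _ Suc]) auto
  ultimately have "bij_betw (nth (sorted_list_of_set I) \<circ> (\<lambda>j. j - 1)) {1..card I} I"
    by (rule bij_betw_trans[rotated])
  then show ?thesis
    by (simp add: elem_at_def[abs_def] comp_def)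
qed

lemma elem_at_strict_mono:
  assumes "finite I" "i \<in> {1..card I}" "j \<in> {1..card I}" "i < j"
  shows "elem_at I i < elem_at I j"
  unfolding elem_at_def using assms
  by (intro sorted_wrt_nth_less[OF strict_sorted_list_of_set]) auto

lemma pattern_less_iff:
  assumes w: "w permutes {1..n}" and I: "I \<subseteq> {1..n}"
    and i: "i \<in> {1..card I}" and j: "j \<in> {1..card I}"
  shows "pattern w I i < pattern w I j \<longleftrightarrow> w (elem_at I i) < w (elem_at I j)"
proof -
  have fin: "finite I" using I finite_subset by blast
  have mem: "elem_at I i \<in> I" "elem_at I j \<in> I"
    using elem_at_bij[OF fin] i j by (auto dest: bij_betwE)
  have mono: "card {c \<in> I. w c \<le> w a} < card {c \<in> I. w c \<le> w b}"
    if "w a < w b" "b \<in> I" for a b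
  proof (rule psubset_card_mono)
    have "b \<in> {c \<in> I. w c \<le> w b}" "b \<notin> {c \<in> I. w c \<le> w a}"
      using that by auto
    moreover have "{c \<in> I. w c \<le> w a} \<subseteq> {c \<in> I. w c \<le> w b}"
      using that by auto
    ultimately show "{c \<in> I. w c \<le> w a} \<subset> {c \<in> I. w c \<le> w b}"
      by blast
  qed (use fin in simp)
  have "card {c \<in> I. w c \<le> w a} \<le> card {c \<in> I. w c \<le> w b}" if "w a \<le> w b" for a b
    using that fin by (intro card_mono) auto
  then have iff: "card {c \<in> I. w c \<le> w a} < card {c \<in> I. w c \<le> w b} \<longleftrightarrow> w a < w b"
    if "b \<in> I" for a b
    using that mono[of a b] by (meson not_less)
  show ?thesis
    using iff[OF mem(2)] i j by (simp add: pattern_def)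
qed

lemma pattern_permutes:
  assumes w: "w permutes {1..n}" and I: "I \<subseteq> {1..n}"
  shows "pattern w I permutes {1..card I}"
proof (rule bij_imp_permutes)
  have fin: "finite I" using I finite_subset by blast
  have "inj_on (pattern w I) {1..card I}"
  proof (rule inj_onI)
    fix i j assume ij: "i \<in> {1..card I}" "j \<in> {1..card I}" "pattern w I i = pattern w I j"
    then have "w (elem_at I i) = w (elem_at I j)"
      using pattern_less_iff[OF w I ij(1,2)] pattern_less_iff[OF w I ij(2,1)] by simp
    then have "elem_at I i = elem_at I j"
      using permutes_inj[OF w] by (auto dest: injD)
    then show "i = j"
      using elem_at_bij[OF fin] ij by (auto simp: bij_betw_def dest: inj_onD)
  qed
  moreover have "pattern w I ` {1..card I} \<subseteq> {1..card I}"
  proof (intro image_subsetI)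
    fix j assume j: "j \<in> {1..card I}"
    then have "elem_at I j \<in> I"
      using elem_at_bij[OF fin] by (auto dest: bij_betwE)
    then have "card {c \<in> I. w c \<le> w (elem_at I j)} > 0"
      using fin by (subst card_gt_0_iff) auto
    moreover have "card {c \<in> I. w c \<le> w (elem_at I j)} \<le> card I"
      using fin by (intro card_mono) auto
    ultimately show "pattern w I j \<in> {1..card I}"
      using j by (simp add: pattern_def)
  qed
  ultimately show "bij_betw (pattern w I) {1..card I} {1..card I}"
    by (simp add: bij_betw_def endo_inj_surj)
qed (auto simp: pattern_def)

lemma pattern_unique:
  assumes w: "w permutes {1..n}" and I: "I \<subseteq> {1..n}"
    and u: "u permutes {1..card I}"
    and ord: "\<And>i j. i \<in> {1..card I} \<Longrightarrow> j \<in> {1..card I} \<Longrightarrow>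
      u i < u j \<longleftrightarrow> w (elem_at I i) < w (elem_at I j)"
  shows "u = pattern w I"
proof
  fix j
  let ?h = "card I"
  have fin: "finite I" using I finite_subset by blast
  show "u j = pattern w I j"
  proof (cases "j \<in> {1..?h}")
    case False
    then show ?thesis using u by (simp add: pattern_def permutes_not_in del: atLeastAtMost_iff)
  next
    case j: True
    then have uj: "u j \<in> {1..?h}" using permutes_in_image[OF u] by blast
    have le: "u i \<le> u j \<longleftrightarrow> w (elem_at I i) \<le> w (elem_at I j)" if "i \<in> {1..?h}" for i
      using ord[OF j that] by (simp add: not_less[symmetric])
    have "u ` {i \<in> {1..?h}. u i \<le> u j} = {1..u j}"
    proof (intro equalityI subsetI)
      fix x assume "x \<in> {1..u j}"
      then have "x \<in> {1..?h}" using uj by auto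
      then have "x \<in> u ` {1..?h}" using permutes_image[OF u] by simp
      with \<open>x \<in> {1..u j}\<close> show "x \<in> u ` {i \<in> {1..?h}. u i \<le> u j}" by auto
    next
      fix x assume "x \<in> u ` {i \<in> {1..?h}. u i \<le> u j}"
      then obtain i where i: "i \<in> {1..?h}" "u i \<le> u j" "x = u i" by auto
      then have "u i \<in> {1..?h}" using permutes_in_image[OF u] by blast
      with i show "x \<in> {1..u j}" by simp
    qed
    then have "card {i \<in> {1..?h}. u i \<le> u j} = u j"
      using card_image[of u "{i \<in> {1..?h}. u i \<le> u j}"] permutes_inj_on[OF u] by simp
    moreover have "{c \<in> I. w c \<le> w (elem_at I j)} = elem_at I ` {i \<in> {1..?h}. u i \<le> u j}"
    proof -
      have I_eq: "I = elem_at I ` {1..?h}"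
        using elem_at_bij[OF fin] by (simp add: bij_betw_def)
      have "{c \<in> elem_at I ` {1..?h}. w c \<le> w (elem_at I j)} =
          elem_at I ` {i \<in> {1..?h}. w (elem_at I i) \<le> w (elem_at I j)}"
        by blast
      also have "{i \<in> {1..?h}. w (elem_at I i) \<le> w (elem_at I j)} = {i \<in> {1..?h}. u i \<le> u j}"
        using le by blast
      finally show ?thesis using I_eq by simp
    qed
    moreover have "inj_on (elem_at I) {i \<in> {1..?h}. u i \<le> u j}"
      using elem_at_bij[OF fin] by (auto simp: bij_betw_def intro: inj_on_subset)
    ultimately show ?thesis using j by (simp add: pattern_def card_image)
  qed
qed

text \<open>
  A word \<open>s\<^bsub>i_l\<^esub> ... s\<^bsub>i_1\<^esub>\<close> is represented by its index sequence \<open>[i_1, ..., i_l]\<close>, that is, it is read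
  from its right end.
\<close>

definition word_perm :: "nat list \<Rightarrow> nat \<Rightarrow> nat" where
  "word_perm xs = fold (\<lambda>i f. transpose i (i + 1) \<circ> f) xs id"

definition reduced_words :: "nat \<Rightarrow> (nat \<Rightarrow> nat) \<Rightarrow> nat list set" where
  "reduced_words n w = {xs. set xs \<subseteq> {1..<n} \<and> word_perm xs = w \<and>
     (\<forall>ys. set ys \<subseteq> {1..<n} \<and> word_perm ys = w \<longrightarrow> length xs \<le> length ys)}"

definition is_inversion :: "(nat \<Rightarrow> nat) \<Rightarrow> nat \<Rightarrow> nat \<Rightarrow> bool" where
  "is_inversion w a b \<longleftrightarrow> a < b \<and> w a > w b"

text \<open>Positions count from \<open>0\<close>: the letter at position \<open>k\<close> is \<open>xs ! k\<close>, the \<open>(k+1)\<close>-st from the right.\<close>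

definition creates :: "nat list \<Rightarrow> nat \<Rightarrow> nat \<Rightarrow> nat \<Rightarrow> bool" where
  "creates xs k a b \<longleftrightarrow>
     is_inversion (word_perm (take (k + 1) xs)) a b \<and> \<not> is_inversion (word_perm (take k xs)) a b"

definition restrict_word :: "nat set \<Rightarrow> nat list \<Rightarrow> nat list" where
  "restrict_word I xs = concat (map (\<lambda>k.
     if \<exists>a\<in>I. \<exists>b\<in>I. creates xs k a b
     then [card {c \<in> I. word_perm (take k xs) c \<le> xs ! k}]
     else []) [0..<length xs])"

text \<open>The order on \<^typ>\<open>nat list\<close> is the lexicographic one.\<close>

definition minimal_lift :: "nat \<Rightarrow> (nat \<Rightarrow> nat) \<Rightarrow> nat set \<Rightarrow> nat list \<Rightarrow> nat list" where
  "minimal_lift n w I x = (LEAST y. y \<in> reduced_words n w \<and> restrict_word I y = x)"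

definition inclusion_exclusion_structure ::
  "(nat \<Rightarrow> (nat \<Rightarrow> nat) \<Rightarrow> 'a set) \<Rightarrow> (nat \<Rightarrow> (nat \<Rightarrow> nat) \<Rightarrow> nat set \<Rightarrow> 'a \<Rightarrow> 'a) \<Rightarrow> bool" where
  "inclusion_exclusion_structure S e \<longleftrightarrow> (\<forall>n w. w permutes {1..n} \<longrightarrow>
     finite (S n w) \<and>
     (\<forall>I \<subseteq> {1..n}. e n w I ` S (card I) (pattern w I) \<subseteq> S n w \<and>
                   inj_on (e n w I) (S (card I) (pattern w I))) \<and>
     (\<forall>I \<subseteq> {1..n}. \<forall>J \<subseteq> {1..n}.
        e n w (I \<inter> J) ` S (card (I \<inter> J)) (pattern w (I \<inter> J)) =
        e n w I ` S (card I) (pattern w I) \<inter> e n w J ` S (card J) (pattern w J)))"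

end

theory Submission
  imports Defs
begin

text \<open>
  A reduced word is read as a wiring diagram: a list of wires in which the letter \<open>i\<close> exchanges the
  neighbours at positions \<open>i\<close> and \<open>i + 1\<close>. A word is reduced exactly when every letter exchanges a
  pair in increasing order, so each pair of wires crosses at most once, and the end of the diagram
  decides which pairs cross (\<open>set_crossings\<close>). Restricting to \<open>I\<close> erases the other wires, and the
  surviving letters form an ascending word on the remaining list (\<open>restrict_wires_correct\<close>).

  Two facts carry the proof. The first is that lifts can be built one letter at a time
  (\<open>lift_exists\<close>): from a state on the way to the final arrangement, any neighbouring pair that still
  has to cross may cross at once, unless both wires lie in \<open>I\<close> and another pair inside \<open>I\<close> has to
  cross earlier. Hence the lexicographically least lift is the one that always takes the least
  letter available. So a reduced word is a minimal lift along \<open>I\<close> if and only if it is greedy: each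
  neighbouring pair that still has to cross and lies to the left of the next letter is blocked, in
  the sense that both wires are in \<open>I\<close> and the pair is not the next one inside \<open>I\<close> to cross
  (\<open>greedy_imp_minimal\<close>, \<open>minimal_imp_greedy\<close>). This criterion no longer mentions other words.

  The second fact is that greediness for \<open>I \<inter> J\<close> is equivalent to greediness for \<open>I\<close> and for \<open>J\<close>.
  A pair blocked for a smaller set is blocked for a larger one, which gives one direction. For the
  other, consider a pair \<open>(a, b)\<close> to the left of the next letter, and suppose that it is the next pair
  inside \<open>I \<inter> J\<close> to cross. The next letter crosses some other pair, which lies outside \<open>I\<close> or
  outside \<open>J\<close>, say outside \<open>I\<close>. If it does not touch \<open>a\<close> and \<open>b\<close>, greediness for \<open>I\<close> forces the
  letter after it to be again to the right of \<open>(a, b)\<close>. If it does, it exchanges \<open>b\<close> with a wire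
  \<open>q \<notin> I\<close>, and greediness for \<open>I\<close> forces \<open>q\<close> to run to the left past \<open>b\<close>, \<open>a\<close> and possibly more
  wires; when \<open>q\<close> stops, \<open>a\<close> and \<open>b\<close> are neighbours again and the next letter is to their right. Either
  way the same violation shows up strictly later in the word (\<open>violation_persists\<close>), so there is no
  last violation, and therefore none (\<open>greedy_Int\<close>).
\<close>

section \<open>Wiring diagrams of words\<close>

text \<open>
  A state lists the wires by position, so it is the inverse of the permutation reached so far. Letters
  count positions from \<open>1\<close>, as in reduced words, while lists count from \<open>0\<close>. Wires may come from any
  linear order, so that the restriction to \<open>I\<close> acts on a sublist without relabelling.
\<close>

definition swap_at :: "nat \<Rightarrow> 'a list \<Rightarrow> 'a list" where
  "swap_at i L = L[i - 1 := L ! i, i := L ! (i - 1)]"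

fun apply_word :: "'a list \<Rightarrow> nat list \<Rightarrow> 'a list" where
  "apply_word L [] = L"
| "apply_word L (i # xs) = apply_word (swap_at i L) xs"

fun crossings :: "'a list \<Rightarrow> nat list \<Rightarrow> ('a \<times> 'a) list" where
  "crossings L [] = []"
| "crossings L (i # xs) = (L ! (i - 1), L ! i) # crossings (swap_at i L) xs"

fun ascending :: "'a::linorder list \<Rightarrow> nat list \<Rightarrow> bool" where
  "ascending L [] \<longleftrightarrow> True"
| "ascending L (i # xs) \<longleftrightarrow>
     0 < i \<and> i < length L \<and> L ! (i - 1) < L ! i \<and> ascending (swap_at i L) xs"

fun inside :: "'a set \<Rightarrow> 'a \<times> 'a \<Rightarrow> bool" where
  "inside I (a, b) \<longleftrightarrow> a \<in> I \<and> b \<in> I"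

abbreviation keep :: "'a set \<Rightarrow> 'a list \<Rightarrow> 'a list" where
  "keep I \<equiv> filter (\<lambda>c. c \<in> I)"

text \<open>
  The new letter is the rank of the left wire of the exchanged pair among the wires in \<open>I\<close>, which
  amounts to the letter of \<open>restrict_word\<close>.
\<close>

fun restrict_wires :: "'a set \<Rightarrow> 'a list \<Rightarrow> nat list \<Rightarrow> nat list" where
  "restrict_wires I L [] = []"
| "restrict_wires I L (i # xs) =
     (if inside I (L ! (i - 1), L ! i) then [length (keep I (take i L))] else []) @
     restrict_wires I (swap_at i L) xs"

text \<open>
  The left-to-right order of the list, as a relation. On lists without repetitions it is a strict
  linear order, and it determines the list among those with the same elements.
\<close>

fun before :: "'a list \<Rightarrow> ('a \<times> 'a) set" where
  "before [] = {}"
| "before (x # L) = {x} \<times> set L \<union> before L"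

lemma adjacent_split:
  assumes "0 < i" "i < length L"
  obtains A a b B where "L = A @ a # b # B" "i = Suc (length A)"
proof -
  obtain t where i: "i = Suc t" using assms(1) by (cases i) auto
  have "L = take t L @ L ! t # L ! Suc t # drop (Suc (Suc t)) L"
    using assms i by (simp add: Cons_nth_drop_Suc)
  moreover have "i = Suc (length (take t L))" using assms i by simp
  ultimately show thesis using that by blast
qed

lemma swap_at_append [simp]:
  "swap_at (Suc (length A)) (A @ a # b # B) = A @ b # a # B"
  by (simp add: swap_at_def nth_append list_update_append)

lemma nth_adjacent [simp]:
  "(A @ a # b # B) ! Suc (length A) = b"
  by (simp add: nth_append)

lemma length_swap_at [simp]: "length (swap_at i L) = length L"
  by (simp add: swap_at_def)

lemma set_swap_at [simp]: "0 < i \<Longrightarrow> i < length L \<Longrightarrow> set (swap_at i L) = set L"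
  by (erule (1) adjacent_split) auto

lemma distinct_swap_at [simp]:
  "0 < i \<Longrightarrow> i < length L \<Longrightarrow> distinct (swap_at i L) = distinct L"
  by (erule (1) adjacent_split) auto

lemma swap_at_map:
  "0 < i \<Longrightarrow> i < length L \<Longrightarrow> swap_at i (map f L) = map f (swap_at i L)"
  by (erule (1) adjacent_split) (simp add: swap_at_append[of "map f A" for A, simplified])

lemma ascending_cases:
  assumes "ascending L (i # xs)"
  obtains A a b B where "L = A @ a # b # B" "i = Suc (length A)" "a < b"
    "ascending (A @ b # a # B) xs"
proof -
  have i: "0 < i" "i < length L" using assms by auto
  obtain A a b B where "L = A @ a # b # B" "i = Suc (length A)" using i by (rule adjacent_split)
  then show thesis using assms that by auto
qed

lemma apply_word_append [simp]: "apply_word L (xs @ ys) = apply_word (apply_word L xs) ys"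
  by (induction xs arbitrary: L) auto

lemma crossings_append:
  "crossings L (xs @ ys) = crossings L xs @ crossings (apply_word L xs) ys"
  by (induction xs arbitrary: L) auto

lemma ascending_append:
  "ascending L (xs @ ys) \<longleftrightarrow> ascending L xs \<and> ascending (apply_word L xs) ys"
  by (induction xs arbitrary: L) auto

lemma restrict_wires_append:
  "restrict_wires I L (xs @ ys) = restrict_wires I L xs @ restrict_wires I (apply_word L xs) ys"
  by (induction xs arbitrary: L) auto

lemma set_apply_word [simp]: "ascending L xs \<Longrightarrow> set (apply_word L xs) = set L"
  by (induction xs arbitrary: L) auto

lemma distinct_apply_word [simp]: "ascending L xs \<Longrightarrow> distinct (apply_word L xs) = distinct L"
  by (induction xs arbitrary: L) auto

lemma before_append: "before (A @ B) = before A \<union> before B \<union> set A \<times> set B"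
  by (induction A) auto

lemma before_keep: "(a, b) \<in> before (keep I L) \<longleftrightarrow> (a, b) \<in> before L \<and> a \<in> I \<and> b \<in> I"
  by (induction L) auto

lemma before_set: "(a, b) \<in> before L \<Longrightarrow> a \<in> set L \<and> b \<in> set L"
  by (induction L) auto

lemma finite_before [simp]: "finite (before L)"
  by (induction L) auto

lemma before_asym: "distinct L \<Longrightarrow> (a, b) \<in> before L \<Longrightarrow> (b, a) \<notin> before L"
  by (induction L) (auto dest: before_set)

lemma before_total: "a \<in> set L \<Longrightarrow> b \<in> set L \<Longrightarrow> a \<noteq> b \<Longrightarrow> (a, b) \<in> before L \<or> (b, a) \<in> before L"
  by (induction L) auto

lemma before_trans: "distinct L \<Longrightarrow> (a, b) \<in> before L \<Longrightarrow> (b, c) \<in> before L \<Longrightarrow> (a, c) \<in> before L"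
  by (induction L) (auto dest: before_set)

lemma before_split:
  "(a, b) \<in> before L \<Longrightarrow> \<exists>A C B. L = A @ a # C @ b # B"
proof (induction L)
  case (Cons x L)
  show ?case
  proof (cases "(a, b) \<in> before L")
    case True
    then obtain A C B where "x # L = (x # A) @ a # C @ b # B" using Cons.IH by auto
    then show ?thesis by blast
  next
    case False
    then have "x = a" "b \<in> set L" using Cons.prems by auto
    then obtain C B where "x # L = [] @ a # C @ b # B" using split_list[of b L] by auto
    then show ?thesis by blast
  qed
qed simp

lemma before_inject:
  assumes "distinct L" "distinct M" "set L = set M" "before L \<subseteq> before M"
  shows "L = M"
  using assms
proof (induction L arbitrary: M)
  case (Cons x L)
  obtain y N where M: "M = y # N" using Cons.prems(3) by (cases M) auto
  have "x = y"
  proof (rule ccontr)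
    assume "x \<noteq> y"
    then have "(x, y) \<in> before (x # L)" "(y, x) \<in> before M"
      using Cons.prems M by auto
    with Cons.prems(4) before_asym[OF Cons.prems(2), of x y] show False by (meson subsetD)
  qed
  have "before L \<subseteq> before N"
  proof
    fix p assume p: "p \<in> before L"
    then have "p \<in> before M" using Cons.prems(4) by auto
    moreover have "fst p \<noteq> x" using p Cons.prems(1) by (cases p) (auto dest: before_set)
    ultimately show "p \<in> before N" using M \<open>x = y\<close> by auto
  qed
  moreover have "set L = set N" using Cons.prems(1-3) M \<open>x = y\<close> by auto
  ultimately have "L = N" using Cons.prems(1,2) M by (intro Cons.IH) auto
  then show ?case using M \<open>x = y\<close> by simp
qed simp

section \<open>Crossings of ascending words\<close>

lemma before_swap:
  "before (A @ a # b # B) = insert (a, b) (before (A @ B) \<union> set A \<times> {a, b} \<union> {a, b} \<times> set B)"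
  by (auto simp: before_append)

text \<open>
  Crossings in an ascending word only create inversions, so an inversion is never undone.
\<close>

lemma before_act_mono:
  assumes "ascending L xs" "(a, b) \<in> before L" "b < a"
  shows "(a, b) \<in> before (apply_word L xs)"
  using assms
proof (induction xs arbitrary: L)
  case (Cons i xs)
  from Cons.prems(1) show ?case
  proof (cases rule: ascending_cases)
    case (1 A c d B)
    then have "(a, b) \<in> before (A @ d # c # B)"
      using Cons.prems by (auto simp: before_swap)
    then show ?thesis using 1 Cons by auto
  qed
qed simp

text \<open>
  A pair crosses at most once, so the pairs that cross are those ordered differently at the two ends;
  in particular, all ascending words between the same two states cross the same pairs.
\<close>

lemma set_crossings:
  assumes "ascending L xs" "distinct L"
  shows "set (crossings L xs) = {(a, b). (a, b) \<in> before L \<and> (b, a) \<in> before (apply_word L xs)}"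
  using assms
proof (induction xs arbitrary: L)
  case Nil
  then show ?case by (auto dest: before_asym)
next
  case (Cons i xs)
  from Cons.prems(1) show ?case
  proof (cases rule: ascending_cases)
    case (1 A a b B)
    let ?L = "A @ b # a # B"
    have d: "distinct ?L" "distinct (apply_word ?L xs)" using 1 Cons.prems(2) by auto
    have ba: "(b, a) \<in> before (apply_word ?L xs)"
      using before_act_mono[OF 1(4), of b a] 1 by (auto simp: before_swap)
    then have ab: "(a, b) \<notin> before (apply_word ?L xs)" using before_asym[OF d(2)] by blast
    have "(c, d) \<in> before L \<longleftrightarrow> (c, d) = (a, b) \<or> (c, d) \<noteq> (b, a) \<and> (c, d) \<in> before ?L" for c d
    proof -
      have "(b, a) \<notin> before L" using before_asym[of L a b] 1 Cons.prems by (auto simp: before_swap)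
      then show ?thesis using 1 by (auto simp: before_swap)
    qed
    then have "{(c, d). (c, d) \<in> before L \<and> (d, c) \<in> before (apply_word ?L xs)} =
      insert (a, b) {(c, d). (c, d) \<in> before ?L \<and> (d, c) \<in> before (apply_word ?L xs)}"
      using ba ab by auto
    then show ?thesis using 1 Cons.IH[OF 1(4) d(1)] by simp
  qed
qed

lemma apply_word_eq_self:
  assumes "ascending L xs" "distinct L" "apply_word L xs = L"
  shows "xs = []"
proof -
  have "set (crossings L xs) = {}"
    using set_crossings[OF assms(1,2)] assms(3) before_asym[OF assms(2)] by (auto simp del: set_empty)
  then show ?thesis by (cases xs) auto
qed

lemma keep_swap:
  assumes "\<not> (a \<in> I \<and> b \<in> I)"
  shows "keep I (A @ b # a # B) = keep I (A @ a # b # B)"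
  using assms by auto

text \<open>
  A crossing inside \<open>I\<close> exchanges neighbours among the wires in \<open>I\<close>, and any other crossing leaves
  their order alone.
\<close>

lemma restrict_wires_correct:
  assumes "ascending L xs"
  shows "ascending (keep I L) (restrict_wires I L xs) \<and>
    apply_word (keep I L) (restrict_wires I L xs) = keep I (apply_word L xs) \<and>
    crossings (keep I L) (restrict_wires I L xs) = filter (inside I) (crossings L xs)"
  using assms
proof (induction xs arbitrary: L)
  case (Cons i xs)
  from Cons.prems(1) show ?case
  proof (cases rule: ascending_cases)
    case (1 A a b B)
    note IH = Cons.IH[OF 1(4)]
    show ?thesis
    proof (cases "a \<in> I \<and> b \<in> I")
      case True
      then show ?thesis using IH 1
        swap_at_append[of "keep I A" a b "keep I B"] nth_adjacent[of "keep I A" a b "keep I B"]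
        by simp
    next
      case False
      then show ?thesis using IH 1 keep_swap[OF False, of A B] by auto
    qed
  qed
qed simp

section \<open>Lifting words from a subset of the wires\<close>

text \<open>
  If no neighbours in the segment were exchanged in \<open>M\<close>, then by transitivity \<open>a\<close> would still precede
  \<open>b\<close> in \<open>M\<close>.
\<close>

lemma inverted_adjacent:
  assumes "distinct M" "(b, a) \<in> before M" "set (a # C @ [b]) \<subseteq> set M" "distinct (a # C @ [b])"
  shows "\<exists>U p q V. a # C @ [b] = U @ p # q # V \<and> (q, p) \<in> before M"
  using assms(2-)
proof (induction C arbitrary: a)
  case Nil
  then show ?case by simp (metis append_Nil)
next
  case (Cons c C)
  show ?case
  proof (cases "(c, a) \<in> before M")
    case True
    have "a # (c # C) @ [b] = [] @ a # c # (C @ [b])" by simp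
    then show ?thesis using True by blast
  next
    case False
    then have "(a, c) \<in> before M" using before_total[of a M c] Cons.prems by auto
    then have bc: "(b, c) \<in> before M" using before_trans[OF assms(1) Cons.prems(1)] by simp
    then obtain U p q V where "c # C @ [b] = U @ p # q # V" "(q, p) \<in> before M"
      using Cons.IH[OF bc] Cons.prems by auto
    then have "a # (c # C) @ [b] = (a # U) @ p # q # V" by simp
    then show ?thesis using \<open>(q, p) \<in> before M\<close> by blast
  qed
qed

text \<open>
  Containment of inversions, that is, the weak order. For states with the same wires it says that
  \<open>M\<close> can be reached from \<open>L\<close> by ascending steps.
\<close>

definition weak_le :: "'a::linorder list \<Rightarrow> 'a list \<Rightarrow> bool" where
  "weak_le L M \<longleftrightarrow> (\<forall>a b. (a, b) \<in> before L \<and> b < a \<longrightarrow> (a, b) \<in> before M)"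

definition discord :: "'a list \<Rightarrow> 'a list \<Rightarrow> ('a \<times> 'a) set" where
  "discord L M = {(a, b). (a, b) \<in> before L \<and> (b, a) \<in> before M}"

lemma weak_le_step:
  assumes "distinct (A @ a # b # B)" "distinct M" "weak_le (A @ a # b # B) M" "(b, a) \<in> before M"
  shows "a < b" "weak_le (A @ b # a # B) M"
    "card (discord (A @ b # a # B) M) < card (discord (A @ a # b # B) M)"
proof -
  have ab: "(a, b) \<notin> before M" using before_asym[OF assms(2)] assms(4) by blast
  have "(a, b) \<in> before (A @ a # b # B)" by (simp add: before_swap)
  then have "\<not> b < a" using ab assms(3) unfolding weak_le_def by blast
  moreover have "a \<noteq> b" using assms(1) by auto
  ultimately show "a < b" by simp
  have sub: "before (A @ b # a # B) \<subseteq> insert (b, a) (before (A @ a # b # B))"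
    by (auto simp: before_swap)
  show "weak_le (A @ b # a # B) M"
    unfolding weak_le_def
  proof (intro allI impI)
    fix c d assume "(c, d) \<in> before (A @ b # a # B) \<and> d < c"
    then show "(c, d) \<in> before M" using sub assms(3,4) unfolding weak_le_def by blast
  qed
  show "card (discord (A @ b # a # B) M) < card (discord (A @ a # b # B) M)"
  proof (rule psubset_card_mono)
    have "discord (A @ a # b # B) M \<subseteq> before (A @ a # b # B)" by (auto simp: discord_def)
    then show "finite (discord (A @ a # b # B) M)" using finite_before finite_subset by blast
    have "(a, b) \<in> discord (A @ a # b # B) M"
      using assms(4) by (simp add: discord_def before_swap)
    moreover have "(a, b) \<notin> before (A @ b # a # B)"
      using before_asym[of "A @ b # a # B" b a] assms(1) by (auto simp: before_swap)
    ultimately show "discord (A @ b # a # B) M \<subset> discord (A @ a # b # B) M"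
      using sub ab unfolding discord_def by blast
  qed
qed

lemma discord_adjacent:
  assumes "distinct L" "distinct M" "set L = set M" "(a, b) \<in> before L" "(b, a) \<in> before M"
  shows "\<exists>A p q B. L = A @ p # q # B \<and> (q, p) \<in> before M"
proof -
  obtain A C B where L: "L = A @ a # C @ b # B" using before_split[OF assms(4)] by blast
  have "set (a # C @ [b]) \<subseteq> set M" "distinct (a # C @ [b])"
    using L assms(1) by (auto simp: assms(3)[symmetric])
  then obtain U p q V where U: "a # C @ [b] = U @ p # q # V" "(q, p) \<in> before M"
    using inverted_adjacent[OF assms(2,5)] by blast
  have "L = A @ (a # C @ [b]) @ B" using L by simp
  also have "\<dots> = (A @ U) @ p # q # (V @ B)" using U(1) by simp
  finally show ?thesis using U(2) by blast
qed

lemma distinct_split_unique: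
  assumes "distinct (A @ a # B)" "A @ a # B = A' @ a # B'"
  shows "A = A'" "B = B'"
proof -
  have "a \<notin> set A" "a \<notin> set B" using assms(1) by auto
  then show "A = A'" "B = B'" using append_Cons_eq_iff[of a A B A' B'] assms(2) by auto
qed

text \<open>
  By induction on the number of pairs that still have to cross. The next pair inside \<open>I\<close> to cross, say
  \<open>(a, b)\<close>, either consists of neighbours, and then it crosses now; or it is separated by wires outside
  \<open>I\<close>, and then some neighbouring pair between \<open>a\<close> and \<open>b\<close> has to cross and is not inside \<open>I\<close>, so its
  crossing does not show in the restriction. If no pair inside \<open>I\<close> is left, any neighbouring pair
  that still has to cross will do.
\<close>

lemma lift_exists:
  assumes "distinct L" "distinct M" "set L = set M" "weak_le L M"
    and "ascending (keep I L) x" "apply_word (keep I L) x = keep I M"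
  shows "\<exists>xs. ascending L xs \<and> apply_word L xs = M \<and> restrict_wires I L xs = x"
  using assms
proof (induction "card (discord L M)" arbitrary: L x rule: less_induct)
  case less
  note L = less.prems(1) and M = less.prems(2) and LM = less.prems(3) and weak = less.prems(4)
  \<comment> \<open>crossing a pair that is not inside \<open>I\<close> reduces to the same lifting problem\<close>
  have step: "\<exists>xs. ascending L xs \<and> apply_word L xs = M \<and> restrict_wires I L xs = x"
    if eq: "L = A @ p # q # B" and qp: "(q, p) \<in> before M" and out: "\<not> (p \<in> I \<and> q \<in> I)" for A p q B
  proof -
    let ?L = "A @ q # p # B"
    note ws = weak_le_step[of A p q B M, folded eq, OF L M weak qp]
    have "\<exists>xs. ascending ?L xs \<and> apply_word ?L xs = M \<and> restrict_wires I ?L xs = x"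
      using L M LM less.prems(5,6) eq ws keep_swap[OF out]
      by (intro less.hyps) auto
    then obtain xs where "ascending ?L xs" "apply_word ?L xs = M" "restrict_wires I ?L xs = x" by blast
    then show ?thesis using eq ws out by (intro exI[of _ "Suc (length A) # xs"]) auto
  qed
  show ?case
  proof (cases x)
    case Nil
    show ?thesis
    proof (cases "before L \<subseteq> before M")
      case True
      then have "L = M" using before_inject L M LM by blast
      then show ?thesis using Nil by (intro exI[of _ "[]"]) auto
    next
      case False
      then obtain a b where ab: "(a, b) \<in> before L" "(a, b) \<notin> before M" by auto
      have "a \<noteq> b" using before_asym[OF L ab(1)] ab(1) by auto
      then have "(b, a) \<in> before M" using before_total[of a M b] before_set[OF ab(1)] LM ab(2) by auto
      then obtain A p q B where eq: "L = A @ p # q # B" "(q, p) \<in> before M"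
        using discord_adjacent[OF L M LM ab(1)] by blast
      have "(p, q) \<in> before L" using eq by (simp add: before_swap)
      moreover have "(p, q) \<notin> before M" using before_asym[OF M eq(2)] .
      moreover have "keep I L = keep I M" using less.prems(6) Nil by simp
      then have "(p, q) \<in> before (keep I L) \<longleftrightarrow> (p, q) \<in> before (keep I M)" by simp
      ultimately have "\<not> (p \<in> I \<and> q \<in> I)" by (auto simp: before_keep)
      then show ?thesis using step eq by blast
    qed
  next
    case (Cons j x')
    have asc: "ascending (keep I L) (j # x')" using less.prems(5) Cons by simp
    then obtain A' a b B' where k: "keep I L = A' @ a # b # B'" "j = Suc (length A')" "a < b"
      "ascending (A' @ b # a # B') x'"
      by (rule ascending_cases)
    have "(a, b) \<in> set (crossings (keep I L) (j # x'))" using k by simp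
    then have "(b, a) \<in> before (keep I M)"
      using set_crossings[OF asc] L less.prems(6) Cons by auto
    then have ba: "(b, a) \<in> before M" "a \<in> I" "b \<in> I" by (auto simp: before_keep)
    have "(a, b) \<in> before (keep I L)" unfolding k(1) by (simp add: before_swap)
    then have "(a, b) \<in> before L" by (simp add: before_keep)
    from before_split[OF this] obtain A C B where eq: "L = A @ a # C @ b # B" by blast
    have kL: "keep I L = keep I A @ a # keep I C @ b # keep I B" using eq ba by simp
    have d: "distinct (keep I A @ a # keep I C @ b # keep I B)"
      unfolding kL[symmetric] using L by simp
    note u = distinct_split_unique[OF d k(1)[unfolded kL]]
    have "distinct (keep I C @ b # keep I B)" using d by simp
    from distinct_split_unique[OF this, of "[]" B'] u
    have C: "keep I A = A'" "keep I C = []" "keep I B = B'" by auto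
    have C_out: "\<forall>c\<in>set C. c \<notin> I" using C(2) by (simp add: filter_empty_conv)
    show ?thesis
    proof (cases C)
      case Nil
      then have eq': "L = A @ a # b # B" using eq by simp
      let ?L = "A @ b # a # B"
      note ws = weak_le_step[of "A" a b B M, folded eq', OF L M weak ba(1)]
      have kL: "keep I ?L = A' @ b # a # B'" using C ba by simp
      have "\<exists>xs. ascending ?L xs \<and> apply_word ?L xs = M \<and> restrict_wires I ?L xs = x'"
        using L M LM eq' ws kL k less.prems(6) Cons by (intro less.hyps) auto
      then obtain xs where "ascending ?L xs" "apply_word ?L xs = M" "restrict_wires I ?L xs = x'" by blast
      moreover have "swap_at (Suc (length A)) L = ?L"
        unfolding eq' by (rule swap_at_append)
      moreover have "L ! length A = a" "L ! Suc (length A) = b"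
        unfolding eq' by (rule nth_append_length nth_adjacent)+
      moreover have "keep I (take (Suc (length A)) L) = A' @ [a]"
        unfolding eq' using C ba by simp
      moreover have "Suc (length A) < length L" unfolding eq' by simp
      ultimately show ?thesis using ws ba Cons k
        by (intro exI[of _ "Suc (length A) # xs"]) simp
    next
      case c: (Cons c C')
      have "set (a # C @ [b]) \<subseteq> set M" "distinct (a # C @ [b])"
        using eq L by (auto simp: LM[symmetric])
      then obtain U p q V where U: "a # C @ [b] = U @ p # q # V" "(q, p) \<in> before M"
        using inverted_adjacent[OF M ba(1)] by blast
      have "p \<notin> I \<or> q \<notin> I"
      proof (cases U)
        case Nil
        then show ?thesis using U c C_out by auto
      next
        case (Cons u U')
        then have "C @ [b] = U' @ p # q # V" using U by simp
        then have "p \<in> set C" by (cases V rule: rev_cases) auto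
        then show ?thesis using C_out by blast
      qed
      moreover have "L = (A @ U) @ p # q # (V @ B)"
      proof -
        have "L = A @ (a # C @ [b]) @ B" using eq by simp
        then show ?thesis unfolding U(1) by simp
      qed
      ultimately show ?thesis using step U(2) by blast
    qed
  qed
qed

lemma weak_le_apply_word: "ascending L xs \<Longrightarrow> weak_le L (apply_word L xs)"
  using before_act_mono unfolding weak_le_def by blast

section \<open>Minimal lifts are the greedy words\<close>

text \<open>
  Here \<open>P\<close> lists the crossings to come. If \<open>p\<close> is among them and blocked, then it lies inside \<open>I\<close> and
  another pair inside \<open>I\<close> crosses before it, so crossing \<open>p\<close> now would change the restriction to \<open>I\<close>.
\<close>

definition blocked :: "'a set \<Rightarrow> ('a \<times> 'a) list \<Rightarrow> 'a \<times> 'a \<Rightarrow> bool" where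
  "blocked I P p \<longleftrightarrow> inside I p \<and> find (inside I) P \<noteq> Some p"

fun greedy :: "'a set \<Rightarrow> 'a list \<Rightarrow> nat list \<Rightarrow> bool" where
  "greedy I L [] \<longleftrightarrow> True"
| "greedy I L (k # xs) \<longleftrightarrow>
     (\<forall>i. 0 < i \<and> i < k \<and> (L ! (i - 1), L ! i) \<in> set (crossings L (k # xs)) \<longrightarrow>
       blocked I (crossings L (k # xs)) (L ! (i - 1), L ! i)) \<and>
     greedy I (swap_at k L) xs"

definition minimal :: "'a::linorder set \<Rightarrow> 'a list \<Rightarrow> nat list \<Rightarrow> bool" where
  "minimal I L xs \<longleftrightarrow> (\<forall>ys. ascending L ys \<and> apply_word L ys = apply_word L xs \<and>
     restrict_wires I L ys = restrict_wires I L xs \<longrightarrow> xs \<le> ys)"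

lemma find_filter: "find P xs = (case filter P xs of [] \<Rightarrow> None | x # _ \<Rightarrow> Some x)"
  by (induction xs) auto

text \<open>
  At the first place where another lift has a smaller letter, that letter crosses a pair which the
  greedy word crosses later. Being blocked, this pair lies inside \<open>I\<close>, so it would be the next
  crossing in the other restriction but is not in this one.
\<close>

lemma greedy_imp_minimal:
  assumes "ascending L xs" "distinct L" "greedy I L xs"
  shows "minimal I L xs"
  unfolding minimal_def
proof (intro allI impI, elim conjE)
  fix ys assume "ascending L ys" "apply_word L ys = apply_word L xs"
    "restrict_wires I L ys = restrict_wires I L xs"
  then show "xs \<le> ys"
    using assms
  proof (induction ys arbitrary: L xs)
    case Nil
    then have "xs = []" using apply_word_eq_self[of L xs] by simp
    then show ?case by simp
  next
    case (Cons i ys)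
    show ?case
    proof (cases xs)
      case Nil
      then show ?thesis by simp
    next
      case xs: (Cons k xs')
      note i = Cons.prems(1) and k = Cons.prems(4)[unfolded xs]
      have "\<not> i < k"
      proof
        assume less: "i < k"
        have cr: "crossings (keep I L) (restrict_wires I L (i # ys)) =
          crossings (keep I L) (restrict_wires I L (k # xs'))"
          using Cons.prems(3) xs by simp
        have fil: "filter (inside I) (crossings L (i # ys)) = filter (inside I) (crossings L (k # xs'))"
          using cr restrict_wires_correct[OF i, of I] restrict_wires_correct[OF k, of I] by simp
        let ?p = "(L ! (i - 1), L ! i)"
        have "?p \<in> set (crossings L (i # ys))" by simp
        then have "?p \<in> set (crossings L (k # xs'))"
          using set_crossings[OF i] set_crossings[OF k] Cons.prems(2,5) xs by auto
        then have "blocked I (crossings L (k # xs')) ?p"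
          using Cons.prems(6) xs less i by auto
        then have ins: "inside I ?p" and "find (inside I) (crossings L (k # xs')) \<noteq> Some ?p"
          unfolding blocked_def by auto
        moreover have "find (inside I) (crossings L (k # xs')) = Some ?p"
          using ins unfolding find_filter fil[symmetric] by simp
        ultimately show False by blast
      qed
      moreover have "xs' \<le> ys" if "i = k"
        using that Cons.prems xs by (intro Cons.IH[of "swap_at k L"]) auto
      ultimately show ?thesis using xs by (cases "i = k") auto
    qed
  qed
qed

text \<open>
  If a pair to the left of the next letter is not blocked, it can cross now without changing the
  restriction to \<open>I\<close>; completing this step by \<open>lift_exists\<close> gives a smaller lift.
\<close>

lemma minimal_imp_greedy:
  assumes "ascending L xs" "distinct L" "minimal I L xs"
  shows "greedy I L xs"
  using assms
proof (induction xs arbitrary: L)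
  case (Cons k xs)
  note asc = Cons.prems(1)
  let ?M = "apply_word L (k # xs)" and ?P = "crossings L (k # xs)"
  have "minimal I (swap_at k L) xs"
    unfolding minimal_def
  proof (intro allI impI, elim conjE)
    fix ys assume ys: "ascending (swap_at k L) ys" "apply_word (swap_at k L) ys = apply_word (swap_at k L) xs"
      "restrict_wires I (swap_at k L) ys = restrict_wires I (swap_at k L) xs"
    then have "ascending L (k # ys)" "apply_word L (k # ys) = apply_word L (k # xs)"
      "restrict_wires I L (k # ys) = restrict_wires I L (k # xs)"
      using asc by auto
    then have "k # xs \<le> k # ys"
      using Cons.prems(3) unfolding minimal_def by blast
    then show "xs \<le> ys" by simp
  qed
  then have tl: "greedy I (swap_at k L) xs" using Cons by auto
  have "blocked I ?P (L ! (i - 1), L ! i)"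
    if i: "0 < i" "i < k" "(L ! (i - 1), L ! i) \<in> set ?P" for i
  proof (rule ccontr)
    assume nb: "\<not> blocked I ?P (L ! (i - 1), L ! i)"
    have "i < length L" using asc i by auto
    then obtain A a b B where L: "L = A @ a # b # B" "i = Suc (length A)"
      using i(1) adjacent_split by metis
    have ab: "L ! (i - 1) = a" "L ! i = b" using L by auto
    let ?L = "A @ b # a # B"
    have ba: "(b, a) \<in> before ?M" using i(3) set_crossings[OF asc Cons.prems(2)] ab by auto
    have dM: "distinct ?M" "set ?M = set L" using asc Cons.prems(2) distinct_apply_word set_apply_word by metis+
    note ws = weak_le_step[of A a b B ?M, folded L(1), OF Cons.prems(2) dM(1) weak_le_apply_word[OF asc] ba]
    note rc = restrict_wires_correct[OF asc, of I]
    have "\<exists>ys. ascending ?L ys \<and> apply_word ?L ys = ?M \<and>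
      restrict_wires I L (i # ys) = restrict_wires I L (k # xs)"
    proof (cases "a \<in> I \<and> b \<in> I")
      case False
      have "\<exists>ys. ascending ?L ys \<and> apply_word ?L ys = ?M \<and>
        restrict_wires I ?L ys = restrict_wires I L (k # xs)"
        using Cons.prems(2) L dM ws rc keep_swap[OF False]
        by (intro lift_exists) (auto simp del: apply_word.simps restrict_wires.simps)
      then show ?thesis using False ab L by auto
    next
      case True
      then have "find (inside I) ?P = Some (a, b)" using nb ab by (auto simp: blocked_def)
      then obtain P' where "filter (inside I) ?P = (a, b) # P'"
        by (auto simp: find_filter split: list.splits)
      then have cr: "crossings (keep I L) (restrict_wires I L (k # xs)) = (a, b) # P'" using rc by simp
      then obtain j x where x: "restrict_wires I L (k # xs) = j # x"
        by (cases "restrict_wires I L (k # xs)") auto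
      have ascx: "ascending (keep I L) (j # x)" using rc x by simp
      obtain A1 c d B1 where j: "keep I L = A1 @ c # d # B1" "j = Suc (length A1)"
        "ascending (A1 @ d # c # B1) x"
        using ascx by (rule ascending_cases)
      have "c = a" "d = b" using cr x j by auto
      \<comment> \<open>the first restricted letter is the rank of \<open>a\<close>, because wires are pairwise distinct\<close>
      have kL: "keep I L = keep I A @ a # b # keep I B" using L True by simp
      have "distinct (keep I A @ a # b # keep I B)"
        unfolding kL[symmetric] using Cons.prems(2) by simp
      from distinct_split_unique[OF this, of A1 "b # B1"]
      have "keep I A = A1 \<and> keep I B = B1"
        using kL j(1) \<open>c = a\<close> \<open>d = b\<close> by simp
      moreover have actx: "apply_word (keep I L) (j # x) = keep I ?M" using rc unfolding x by blast
      ultimately have j': "j = Suc (length (keep I A))" "ascending (keep I ?L) x"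
        "apply_word (keep I ?L) x = keep I ?M"
        using j kL \<open>c = a\<close> \<open>d = b\<close> True by auto
      have "\<exists>ys. ascending ?L ys \<and> apply_word ?L ys = ?M \<and> restrict_wires I ?L ys = x"
        using Cons.prems(2) L dM ws j'
        by (intro lift_exists) (auto simp del: apply_word.simps restrict_wires.simps)
      then show ?thesis using True x j' ab L by auto
    qed
    then obtain ys where ys: "ascending ?L ys" "apply_word ?L ys = ?M"
      "restrict_wires I L (i # ys) = restrict_wires I L (k # xs)"
      by blast
    have "ascending L (i # ys)" "apply_word L (i # ys) = ?M" using ys L ws(1) by auto
    then have "k # xs \<le> i # ys" using Cons.prems(3) ys(3) unfolding minimal_def by blast
    then show False using i(2) by simp
  qed
  then show ?case using tl by simp
qed simp

section \<open>Greedy words for an intersection\<close>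

lemma not_blocked_head: "\<not> blocked I (p # P) p"
  by (simp add: blocked_def)

lemma blocked_Cons: "\<not> inside I p \<Longrightarrow> blocked I (p # P) = blocked I P"
  by (simp add: blocked_def fun_eq_iff)

lemma find_append:
  "find Q (xs @ ys) = (case find Q xs of None \<Rightarrow> find Q ys | Some x \<Rightarrow> Some x)"
  by (induction xs) auto

lemma find_SomeD: "find Q xs = Some x \<Longrightarrow> x \<in> set xs"
  by (auto simp: find_Some_iff)

lemma greedy_append: "greedy I L (xs @ ys) \<Longrightarrow> greedy I (apply_word L xs) ys"
  by (induction xs arbitrary: L) auto

text \<open>
  The state \<open>L\<close> arises from \<open>A @ C @ [q] @ B\<close>, where \<open>A @ C\<close> ends in \<open>a, b\<close>, by moving the wire \<open>q\<close> to the
  left past \<open>C\<close>. Every neighbouring pair of \<open>A @ C\<close> that has yet to cross is blocked, since \<open>q\<close> started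
  its run while the word was greedy and crossings with \<open>q\<close> are not inside \<open>I\<close>. Hence the next letter
  cannot cross a pair within \<open>A\<close> or within \<open>C\<close>, and \<open>q\<close> has already passed the wire to its right. So
  either \<open>q\<close> moves on, or the next letter lies to the right of \<open>C\<close>. In the latter case \<open>a\<close> and \<open>b\<close>
  are neighbours to the left of the next letter, unless \<open>q\<close> still separates them; but then \<open>(a, q)\<close>
  is an unblocked crossing to the left of the next letter, which a greedy word does not allow.
\<close>

lemma violation_behind_moving_wire:
  assumes "ascending L xs" "distinct L" "greedy I L xs"
    and "L = A @ q # C @ B" "A @ C = D @ [a, b]" "C \<noteq> []" "q \<notin> I" "\<forall>c\<in>set C. c < q"
    and "\<And>t. Suc t < length (A @ C) \<Longrightarrow>
      ((A @ C) ! t, (A @ C) ! Suc t) \<in> set (crossings L xs) \<Longrightarrow>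
      blocked I (crossings L xs) ((A @ C) ! t, (A @ C) ! Suc t)"
    and "(a, b) \<in> set (crossings L xs)"
    and "2 \<le> length C \<or> (a, q) \<in> set (crossings L xs)"
  shows "\<exists>pre j suf i. xs = pre @ j # suf \<and> 0 < i \<and> i < j \<and>
    apply_word L pre ! (i - 1) = a \<and> apply_word L pre ! i = b \<and> (a, b) \<notin> set (crossings L pre)"
  using assms
proof (induction xs arbitrary: L A C)
  case Nil
  then show ?case by simp
next
  case (Cons j xs)
  note asc = Cons.prems(1) and L = Cons.prems(4) and D = Cons.prems(5) and free = Cons.prems(9)
  let ?P = "crossings L (j # xs)"
  let ?p = "(L ! (j - 1), L ! j)"
  have pP: "?p \<in> set ?P" by simp
  have nb: "\<not> blocked I ?P ?p" using not_blocked_head by simp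
  have j0: "0 < j" and jlt: "L ! (j - 1) < L ! j" using asc by auto
  \<comment> \<open>a neighbouring pair of \<open>A @ C\<close> is blocked, and the pair that crosses next never is\<close>
  have not_old: False if "Suc t < length (A @ C)" "?p = ((A @ C) ! t, (A @ C) ! Suc t)" for t
    using free[OF that(1)] pP nb unfolding that(2)[symmetric] by blast
  have len: "length D + 2 = length A + length C" using arg_cong[OF D, of length] by simp
  have b: "b \<in> set (A @ C)" unfolding D by simp
  consider "j < length A" | "j = length A" | "j = Suc (length A)"
    | "Suc (length A) < j" "j < Suc (length A + length C)" | "Suc (length A + length C) \<le> j"
    by linarith
  then show ?case
  proof cases
    case 1
    then show ?thesis using not_old[of "j - 1"] j0 L by (cases j) (auto simp: nth_append)
  next
    case 2
    then obtain A1 c where A: "A = A1 @ [c]" using j0 by (cases A rule: rev_cases) auto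
    have L': "L = A1 @ c # q # C @ B" using L A by simp
    have p: "?p = (c, q)" using L' 2 A by simp
    have sw: "swap_at j L = A1 @ q # (c # C) @ B" using L' 2 A by simp
    have P: "?P = (c, q) # crossings (swap_at j L) xs" using p by simp
    have out: "\<not> inside I (c, q)" using Cons.prems(7) by simp
    have "\<exists>pre k suf i. xs = pre @ k # suf \<and> 0 < i \<and> i < k \<and>
      apply_word (swap_at j L) pre ! (i - 1) = a \<and> apply_word (swap_at j L) pre ! i = b \<and>
      (a, b) \<notin> set (crossings (swap_at j L) pre)"
    proof (rule Cons.IH[OF _ _ _ sw])
      show "ascending (swap_at j L) xs" "distinct (swap_at j L)" "greedy I (swap_at j L) xs"
        using Cons.prems(1-3) by auto
      show "A1 @ c # C = D @ [a, b]" using D A by simp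
      show "c # C \<noteq> []" by simp
      show "q \<notin> I" by fact
      show "\<forall>d\<in>set (c # C). d < q" using Cons.prems(8) jlt p by auto
      have "b \<noteq> q" using b Cons.prems(2) L by auto
      then show "(a, b) \<in> set (crossings (swap_at j L) xs)" using Cons.prems(10) P by auto
      show "2 \<le> length (c # C) \<or> (a, q) \<in> set (crossings (swap_at j L) xs)"
        using Cons.prems(6) by (cases C) auto
      show "blocked I (crossings (swap_at j L) xs) ((A1 @ c # C) ! t, (A1 @ c # C) ! Suc t)"
        if "Suc t < length (A1 @ c # C)"
          "((A1 @ c # C) ! t, (A1 @ c # C) ! Suc t) \<in> set (crossings (swap_at j L) xs)" for t
        using free[of t] that unfolding P blocked_Cons[OF out] A by simp
    qed
    then obtain pre k suf i where w: "xs = pre @ k # suf" "0 < i" "i < k"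
      "apply_word (swap_at j L) pre ! (i - 1) = a" "apply_word (swap_at j L) pre ! i = b"
      "(a, b) \<notin> set (crossings (swap_at j L) pre)" by blast
    have "(a, b) \<noteq> (c, q)" using b Cons.prems(2) L by auto
    then have "(a, b) \<notin> set (crossings L (j # pre))" using w(6) p by auto
    then show ?thesis using w by (intro exI[of _ "j # pre"] exI[of _ k] exI[of _ suf] exI[of _ i]) simp
  next
    case 3
    then have "L ! (j - 1) = q" "L ! j \<in> set C"
      using L Cons.prems(6) by (auto simp: nth_append neq_Nil_conv)
    then show ?thesis using Cons.prems(8) jlt by fastforce
  next
    case 4
    then obtain t where t: "j = Suc (Suc t)" by (cases j; cases "j - 1") auto
    have "L ! (j - 1) = (A @ C) ! t" "L ! j = (A @ C) ! Suc t"
      using 4 t L by (auto simp: nth_append nth_Cons' Suc_diff_le)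
    then show ?thesis using not_old[of t] 4 t by simp
  next
    case 5
    show ?thesis
    proof (cases "2 \<le> length C")
      case True
      let ?i = "Suc (Suc (length D))"
      obtain m where m: "length C = Suc (Suc m)" using True by (metis add_2_eq_Suc le_Suc_ex)
      then have "length D = length A + m" using len by simp
      then have "L ! Suc (length D) = (A @ C) ! length D" "L ! ?i = (A @ C) ! Suc (length D)"
        using m L by (auto simp: nth_append)
      then have "L ! (?i - 1) = a" "L ! ?i = b" unfolding D by (auto simp: nth_append)
      moreover have "?i < j" using 5 len by simp
      ultimately show ?thesis
        by (intro exI[of _ "[]"] exI[of _ j] exI[of _ xs] exI[of _ ?i]) simp
    next
      case False
      then obtain c where "C = [c]" using Cons.prems(6) by (cases C; cases "tl C") auto
      then have C: "C = [b]" "A = D @ [a]" using D by (auto simp: append_eq_append_conv2)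
      have aq: "L ! (length A - 1) = a" "L ! length A = q" using L C by (auto simp: nth_append)
      have "blocked I ?P (L ! (i - 1), L ! i)"
        if "0 < i" "i < j" "(L ! (i - 1), L ! i) \<in> set ?P" for i
        using Cons.prems(3) that unfolding greedy.simps by blast
      moreover have "0 < length A" "length A < j" using 5 C(2) by simp_all
      moreover have "(a, q) \<in> set ?P" using Cons.prems(11) False by blast
      ultimately have "blocked I ?P (L ! (length A - 1), L ! length A)" unfolding aq[symmetric] by blast
      then show ?thesis using Cons.prems(7) aq by (simp add: blocked_def)
    qed
  qed
qed

text \<open>
  The case distinction is whether the first crossing involves the wire \<open>b\<close> at position \<open>i + 1\<close>. If not,
  the letter after it cannot be at most \<open>i\<close>: its pair would have been in place, and unblocked, one step
  earlier. If so, the wire that passed \<open>b\<close> is outside \<open>I\<close> and starts a run to the left.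
\<close>

lemma violation_persists:
  assumes asc: "ascending L (k # xs)" and dist: "distinct L" and gr: "greedy I L (k # xs)"
    and out: "\<not> inside I (L ! (k - 1), L ! k)"
    and i: "0 < i" "i < k" and ab: "L ! (i - 1) = a" "L ! i = b"
    and P: "(a, b) \<in> set (crossings L (k # xs))"
  shows "\<exists>pre j suf i. xs = pre @ j # suf \<and> 0 < i \<and> i < j \<and>
    apply_word (swap_at k L) pre ! (i - 1) = a \<and> apply_word (swap_at k L) pre ! i = b \<and>
    (a, b) \<notin> set (crossings (swap_at k L) pre)"
proof -
  let ?P = "crossings L (k # xs)" and ?L = "swap_at k L"
  have k: "k < length L" "L ! (k - 1) < L ! k" and asc': "ascending ?L xs" using asc by auto
  have blk: "blocked I ?P (L ! (t - 1), L ! t)"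
    if "0 < t" "t < k" "(L ! (t - 1), L ! t) \<in> set ?P" for t
    using gr that by auto
  have Ptl: "blocked I ?P = blocked I (crossings ?L xs)" using blocked_Cons[OF out] by simp
  have abI: "a \<in> I" "b \<in> I" using blk[OF i] P ab by (auto simp: blocked_def)
  have "b \<noteq> L ! k" using nth_eq_iff_index_eq[OF dist, of i k] i k ab by auto
  then have P': "(a, b) \<in> set (crossings ?L xs)" using P by auto
  then obtain j xs' where xs: "xs = j # xs'" by (cases xs) auto
  show ?thesis
  proof (cases "Suc i < k")
    case True
    have same: "?L ! t = L ! t" if "Suc t < k" for t
      using that by (simp add: swap_at_def)
    show ?thesis
    proof (cases "i < j")
      case True
      then show ?thesis using same[of i] same[of "i - 1"] \<open>Suc i < k\<close> i ab xs
        by (intro exI[of _ "[]"] exI[of _ j] exI[of _ xs'] exI[of _ i]) simp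
    next
      case False
      have j: "0 < j" "j < k" using asc' False i xs by auto
      let ?p = "(?L ! (j - 1), ?L ! j)"
      have p: "?p = (L ! (j - 1), L ! j)" using same[of j] same[of "j - 1"] False \<open>Suc i < k\<close> j by simp
      have "?p \<in> set ?P" using xs by simp
      then have "blocked I ?P ?p" using blk[OF j] unfolding p by simp
      then have "blocked I (crossings ?L xs) ?p" unfolding Ptl .
      moreover have "\<not> blocked I (crossings ?L xs) ?p" unfolding xs by (simp add: not_blocked_head)
      ultimately show ?thesis by blast
    qed
  next
    case False
    then have ki: "k = Suc i" using i by simp
    have "i < length L" using i k by simp
    with i(1) obtain D x y B0 where D: "L = D @ x # y # B0" "i = Suc (length D)"
      by (rule adjacent_split)
    have "B0 \<noteq> []" using k ki D by auto
    then obtain q B where B0: "B0 = q # B" by (cases B0) auto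
    have L: "L = (D @ [a]) @ b # q # B" using D B0 ab by simp
    have kk: "k = Suc (length (D @ [a]))" using ki D by simp
    have bq: "L ! (k - 1) = b" "L ! k = q" unfolding L kk by (simp_all add: nth_append)
    have sw: "?L = (D @ [a]) @ q # [b] @ B" unfolding L kk swap_at_append by simp
    \<comment> \<open>\<open>q\<close> ends up to the left of \<open>b\<close>, which ends up to the left of \<open>a\<close>, so \<open>a\<close> and \<open>q\<close> still have to cross\<close>
    have "(b, q) \<in> set ?P" using bq by simp
    then have qb: "(q, b) \<in> before (apply_word L (k # xs))" using set_crossings[OF asc dist] by auto
    have ba: "(b, a) \<in> before (apply_word L (k # xs))" using P set_crossings[OF asc dist] by auto
    have "distinct (apply_word L (k # xs))" using asc dist distinct_apply_word by blast
    then have "(q, a) \<in> before (apply_word L (k # xs))" using before_trans qb ba by fast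
    moreover have "(a, q) \<in> before ?L" unfolding sw by (simp add: before_append)
    moreover have dist': "distinct ?L" using dist asc by auto
    ultimately have aq: "(a, q) \<in> set (crossings ?L xs)" using set_crossings[OF asc'] by auto
    show ?thesis
    proof (rule violation_behind_moving_wire[OF asc' dist' _ sw])
      show "greedy I ?L xs" using gr by simp
      show "(D @ [a]) @ [b] = D @ [a, b]" by simp
      show "q \<notin> I" using out abI bq by simp
      show "\<forall>c\<in>set [b]. c < q" using k bq by simp
      show "(a, b) \<in> set (crossings ?L xs)" by (rule P')
      show "2 \<le> length [b] \<or> (a, q) \<in> set (crossings ?L xs)" using aq by simp
      show "blocked I (crossings ?L xs) (((D @ [a]) @ [b]) ! t, ((D @ [a]) @ [b]) ! Suc t)"
        if t: "Suc t < length ((D @ [a]) @ [b])"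
          "(((D @ [a]) @ [b]) ! t, ((D @ [a]) @ [b]) ! Suc t) \<in> set (crossings ?L xs)" for t
      proof -
        have "L = ((D @ [a]) @ [b]) @ q # B" using L by simp
        then have "((D @ [a]) @ [b]) ! s = L ! s" if "s < length ((D @ [a]) @ [b])" for s
          using that nth_append_left by metis
        then have "((D @ [a]) @ [b]) ! t = L ! t" "((D @ [a]) @ [b]) ! Suc t = L ! Suc t"
          using t(1) Suc_lessD by blast+
        then show ?thesis using blk[of "Suc t"] t kk unfolding Ptl by simp
      qed
    qed simp
  qed
qed

text \<open>
  By induction on the word, every later suffix is greedy for \<open>I \<inter> J\<close>, while \<open>violation_persists\<close> turns a
  violation at the first letter into one at a later letter.
\<close>

lemma greedy_Int:
  assumes "ascending L xs" "distinct L" "greedy I L xs" "greedy J L xs"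
  shows "greedy (I \<inter> J) L xs"
  using assms
proof (induction xs arbitrary: L)
  case (Cons k xs)
  let ?P = "crossings L (k # xs)" and ?L = "swap_at k L"
  have tl: "greedy (I \<inter> J) ?L xs" using Cons by auto
  have k: "k < length L" using Cons.prems by auto
  have "blocked (I \<inter> J) ?P (L ! (i - 1), L ! i)"
    if i: "0 < i" "i < k" "(L ! (i - 1), L ! i) \<in> set ?P" for i
  proof -
    define a b where ab: "a = L ! (i - 1)" "b = L ! i"
    have blk: "blocked I ?P (a, b)" "blocked J ?P (a, b)"
      using Cons.prems(3,4) i unfolding ab by auto
    then have ins: "inside (I \<inter> J) (a, b)" by (auto simp: blocked_def)
    let ?p = "(L ! (k - 1), L ! k)"
    have ne: "?p \<noteq> (a, b)" using nth_eq_iff_index_eq[OF Cons.prems(2), of i k] i k ab by auto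
    have "find (inside (I \<inter> J)) ?P \<noteq> Some (a, b)"
    proof (cases "inside (I \<inter> J) ?p")
      case True
      then show ?thesis using ne by simp
    next
      case False
      then have "\<not> inside I ?p \<or> \<not> inside J ?p" by auto
      then obtain pre j suf i' where w: "xs = pre @ j # suf" "0 < i'" "i' < j"
        "apply_word ?L pre ! (i' - 1) = a" "apply_word ?L pre ! i' = b" "(a, b) \<notin> set (crossings ?L pre)"
        using violation_persists[OF Cons.prems(1,2,3) _ i(1,2) ab[symmetric]]
          violation_persists[OF Cons.prems(1,2,4) _ i(1,2) ab[symmetric]] i(3) unfolding ab
        by blast
      let ?Q = "crossings (apply_word ?L pre) (j # suf)"
      have split: "crossings ?L xs = crossings ?L pre @ ?Q" using w(1) by (simp add: crossings_append)
      have "(a, b) \<in> set (crossings ?L xs)" using i(3) ne ab by auto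
      then have "(a, b) \<in> set ?Q" using split w(6) by auto
      moreover have "greedy (I \<inter> J) (apply_word ?L pre) (j # suf)"
        using greedy_append tl w(1) by blast
      ultimately have "blocked (I \<inter> J) ?Q (a, b)" using w(2-5) by auto
      then have "find (inside (I \<inter> J)) ?Q \<noteq> Some (a, b)" by (simp add: blocked_def)
      then have "find (inside (I \<inter> J)) (crossings ?L xs) \<noteq> Some (a, b)"
        unfolding split find_append using w(6) find_SomeD
        by (fastforce split: option.splits)
      then show ?thesis using False by auto
    qed
    then show ?thesis using ins unfolding blocked_def ab by simp
  qed
  then show ?case using tl by simp
qed simp

text \<open>
  If a pair inside \<open>K\<close> is the next crossing inside \<open>I \<supseteq> K\<close>, it is also the next crossing inside \<open>K\<close>, so
  a pair blocked for \<open>K\<close> is blocked for \<open>I\<close>.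
\<close>

lemma greedy_mono:
  assumes "greedy K L xs" "K \<subseteq> I"
  shows "greedy I L xs"
  using assms(1)
proof (induction xs arbitrary: L)
  case (Cons k xs)
  have "blocked I P p" if "blocked K P p" for P p
  proof (cases p)
    case (Pair a b)
    have "find (inside K) P = Some (a, b)"
      if "find (inside I) P = Some (a, b)" "a \<in> K" "b \<in> K"
      using that(1)
    proof (induction P)
      case (Cons x P)
      then show ?case using assms(2) that by (cases x) (auto split: if_splits)
    qed simp
    then show ?thesis using \<open>blocked K P p\<close> assms(2) Pair by (auto simp: blocked_def)
  qed
  then show ?case using Cons by auto
qed simp

section \<open>Reduced words are the ascending words\<close>

definition inv_count :: "'a::linorder list \<Rightarrow> nat" where
  "inv_count L = card {(a, b). (a, b) \<in> before L \<and> b < a}"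

lemma inv_count_swap:
  assumes "distinct (A @ a # b # B)" "a < b"
  shows "inv_count (A @ b # a # B) = Suc (inv_count (A @ a # b # B))"
proof -
  let ?S = "{(c, d). (c, d) \<in> before (A @ a # b # B) \<and> d < c}"
  have "(b, a) \<notin> before (A @ a # b # B)"
    by (rule before_asym[OF assms(1)]) (simp add: before_swap)
  then have "(b, a) \<notin> ?S" by simp
  moreover have "{(c, d). (c, d) \<in> before (A @ b # a # B) \<and> d < c} = insert (b, a) ?S"
    using assms(2) by (auto simp: before_swap)
  moreover have "finite ?S" by (rule finite_subset[OF _ finite_before]) auto
  ultimately show ?thesis by (simp add: inv_count_def)
qed

lemma ascending_letters: "ascending L xs \<Longrightarrow> set xs \<subseteq> {1..<length L}"
  by (induction xs arbitrary: L) fastforce+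

text \<open>
  Each letter changes the number of inversions by one, upwards exactly when it exchanges an increasing
  pair.
\<close>

lemma inv_count_apply_word:
  assumes "distinct L" "set xs \<subseteq> {1..<length L}"
  shows "inv_count (apply_word L xs) \<le> inv_count L + length xs"
    and "inv_count (apply_word L xs) = inv_count L + length xs \<longleftrightarrow> ascending L xs"
proof -
  have "inv_count (apply_word L xs) \<le> inv_count L + length xs \<and>
    (inv_count (apply_word L xs) = inv_count L + length xs \<longleftrightarrow> ascending L xs)"
    using assms
  proof (induction xs arbitrary: L)
    case (Cons i xs)
    have "0 < i" "i < length L" using Cons.prems by auto
    then obtain A a b B where L: "L = A @ a # b # B" "i = Suc (length A)" by (rule adjacent_split)
    let ?L = "A @ b # a # B"
    have "distinct ?L" "set xs \<subseteq> {1..<length ?L}" using Cons.prems L by auto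
    note IH = Cons.IH[OF this]
    show ?case
    proof (cases "a < b")
      case True
      then have "inv_count ?L = Suc (inv_count L)" using inv_count_swap Cons.prems L by blast
      then show ?thesis using IH L True by auto
    next
      case False
      then have "b < a" using Cons.prems L by auto
      then have "inv_count L = Suc (inv_count ?L)" using inv_count_swap \<open>distinct ?L\<close> L by blast
      then show ?thesis using IH L False by auto
    qed
  qed simp
  then show "inv_count (apply_word L xs) \<le> inv_count L + length xs"
    and "inv_count (apply_word L xs) = inv_count L + length xs \<longleftrightarrow> ascending L xs" by auto
qed

text \<open>
  The state in which every word for \<open>w\<close> ends, starting from \<open>1, \<dots>, n\<close>.
\<close>

definition wires :: "nat \<Rightarrow> (nat \<Rightarrow> nat) \<Rightarrow> nat list" where
  "wires n w = map (inv w) [1..<Suc n]"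

lemma length_wires [simp]: "length (wires n w) = n"
  by (simp add: wires_def)

lemma wires_nth: "0 < i \<Longrightarrow> i \<le> n \<Longrightarrow> wires n w ! (i - 1) = inv w i"
  by (simp add: wires_def del: upt_Suc)

lemma set_wires [simp]: "w permutes {1..n} \<Longrightarrow> set (wires n w) = {1..n}"
  using permutes_image[OF permutes_inv, of w "{1..n}"]
  by (simp add: wires_def atLeastLessThanSuc_atLeastAtMost del: upt_Suc)

lemma distinct_wires [simp]: "w permutes {1..n} \<Longrightarrow> distinct (wires n w)"
  by (simp add: wires_def distinct_map permutes_inj_on[OF permutes_inv] del: upt_Suc)

lemma wires_inject:
  assumes "w permutes {1..n}" "u permutes {1..n}" "wires n w = wires n u"
  shows "w = u"
proof -
  have "inv w i = inv u i" for i
  proof (cases "i \<in> {1..n}")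
    case True
    then show ?thesis using wires_nth[of i n w] wires_nth[of i n u] assms(3) by simp
  next
    case False
    then show ?thesis using assms(1,2) permutes_inv permutes_not_in by metis
  qed
  then have "inv w = inv u" by blast
  then show ?thesis using assms(1,2) permutes_inv_inv by metis
qed

lemma word_perm_snoc: "word_perm (xs @ [i]) = transpose i (i + 1) \<circ> word_perm xs"
  by (simp add: word_perm_def)

lemma word_perm_permutes: "set xs \<subseteq> {1..<n} \<Longrightarrow> word_perm xs permutes {1..n}"
proof (induction xs rule: rev_induct)
  case Nil
  then show ?case using permutes_id by (simp add: word_perm_def id_def)
next
  case (snoc i xs)
  then have "transpose i (i + 1) permutes {1..n}" by (intro permutes_swap_id) auto
  then show ?case using snoc unfolding word_perm_snoc by (intro permutes_compose) auto
qed

lemma swap_at_wires: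
  assumes "0 < i" "i < n" "u permutes {1..n}"
  shows "swap_at i (wires n u) = wires n (transpose i (i + 1) \<circ> u)"
proof (rule nth_equalityI)
  have inv: "inv (transpose i (Suc i) \<circ> u) = inv u \<circ> transpose i (Suc i)"
    using permutes_bij[OF assms(3)] by (simp add: o_inv_distrib bij_is_inj bij_is_surj)
  fix p assume "p < length (swap_at i (wires n u))"
  then have p: "p < n" by simp
  have nth: "wires n f ! q = inv f (Suc q)" if "q < n" for q f
    using wires_nth[of "Suc q" n f] that by simp
  show "swap_at i (wires n u) ! p = wires n (transpose i (i + 1) \<circ> u) ! p"
    using assms(1,2) p
    by (auto simp: nth inv swap_at_def nth_list_update transpose_def)
qed simp

lemma apply_word_upt:
  "set xs \<subseteq> {1..<n} \<Longrightarrow> apply_word [1..<Suc n] xs = wires n (word_perm xs)"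
proof (induction xs rule: rev_induct)
  case Nil
  then show ?case by (simp add: word_perm_def wires_def)
next
  case (snoc i xs)
  then show ?case using swap_at_wires[of i n "word_perm xs"] word_perm_permutes[of xs n]
    by (simp add: word_perm_snoc comp_def del: upt_Suc)
qed

lemma before_upt: "(a, b) \<in> before [m..<n] \<Longrightarrow> a < b"
  by (induction n) (auto simp: before_append split: if_splits)

lemma inv_count_upt: "inv_count [m..<n] = 0"
proof -
  have "{(a, b). (a, b) \<in> before [m..<n] \<and> b < a} = {}" using before_upt by fastforce
  then show ?thesis unfolding inv_count_def by (simp only: card.empty)
qed

lemma lift_to_wires:
  assumes w: "w permutes {1..n}"
    and x: "ascending (keep I [1..<Suc n]) x" "apply_word (keep I [1..<Suc n]) x = keep I (wires n w)"
  shows "\<exists>xs. ascending [1..<Suc n] xs \<and> apply_word [1..<Suc n] xs = wires n w \<and>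
    restrict_wires I [1..<Suc n] xs = x"
proof (rule lift_exists[OF _ _ _ _ x])
  show "distinct [1..<Suc n]" "distinct (wires n w)" using w by (simp_all del: upt_Suc)
  show "set [1..<Suc n] = set (wires n w)"
    using w by (simp add: atLeastLessThanSuc_atLeastAtMost del: upt_Suc)
  show "weak_le [1..<Suc n] (wires n w)"
    unfolding weak_le_def using before_upt by fastforce
qed

text \<open>
  No word for \<open>w\<close> is shorter than the number of inversions of \<open>w\<close>, with equality for the ascending words
  only; and an ascending word exists, by lifting the empty word from the empty set of wires.
\<close>

lemma reduced_words_iff:
  assumes w: "w permutes {1..n}"
  shows "xs \<in> reduced_words n w \<longleftrightarrow> ascending [1..<Suc n] xs \<and> apply_word [1..<Suc n] xs = wires n w"
proof -
  let ?L = "[1..<Suc n]"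
  have asc_set: "set ys \<subseteq> {1..<n}" if "ascending ?L ys" for ys
    using ascending_letters[OF that] by (simp del: upt_Suc)
  have len: "inv_count (wires n w) \<le> length ys"
    "inv_count (wires n w) = length ys \<longleftrightarrow> ascending ?L ys"
    if "set ys \<subseteq> {1..<n}" "apply_word ?L ys = wires n w" for ys
    using inv_count_apply_word[of ?L ys] that by (simp_all add: inv_count_upt del: upt_Suc)
  show ?thesis
  proof
    assume xs: "xs \<in> reduced_words n w"
    then have s: "set xs \<subseteq> {1..<n}" and wp: "word_perm xs = w" by (auto simp: reduced_words_def)
    have apply_word: "apply_word ?L xs = wires n w" using apply_word_upt[OF s] wp by simp
    obtain ys where ys: "ascending ?L ys" "apply_word ?L ys = wires n w"
      using lift_to_wires[OF w, of "{}" "[]"] by auto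
    have "wires n (word_perm ys) = wires n w" using apply_word_upt[OF asc_set[OF ys(1)]] ys by simp
    then have "word_perm ys = w" using wires_inject word_perm_permutes[OF asc_set[OF ys(1)]] w by blast
    then have "length xs \<le> length ys" using xs asc_set[OF ys(1)] by (simp add: reduced_words_def)
    moreover have "inv_count (wires n w) = length ys" using len(2)[OF asc_set[OF ys(1)] ys(2)] ys by simp
    ultimately show "ascending ?L xs \<and> apply_word ?L xs = wires n w"
      using len[OF s apply_word] apply_word by simp
  next
    assume xs: "ascending ?L xs \<and> apply_word ?L xs = wires n w"
    then have s: "set xs \<subseteq> {1..<n}" using asc_set by blast
    have "wires n (word_perm xs) = wires n w" using apply_word_upt[OF s] xs by simp
    then have wp: "word_perm xs = w" using wires_inject word_perm_permutes[OF s] w by blast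
    have "length xs \<le> length ys" if "set ys \<subseteq> {1..<n}" "word_perm ys = w" for ys
      using len(1)[OF that(1)] apply_word_upt[OF that(1)] that(2) len(2)[OF s] xs by simp
    then show "xs \<in> reduced_words n w" using s wp by (simp add: reduced_words_def)
  qed
qed

lemma finite_reduced_words: "finite (reduced_words n w)"
proof (cases "reduced_words n w = {}")
  case False
  then obtain xs where xs: "xs \<in> reduced_words n w" by blast
  have "reduced_words n w \<subseteq> {ys. set ys \<subseteq> {1..<n} \<and> length ys = length xs}"
    using xs by (auto simp: reduced_words_def intro!: antisym)
  then show ?thesis by (rule finite_subset) (intro finite_lists_length_eq finite_atLeastLessThan)
qed simp

section \<open>Restriction to a pattern\<close>

lemma restrict_word_snoc:
  "restrict_word I (xs @ [i]) = restrict_word I xs @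
     (if \<exists>a\<in>I. \<exists>b\<in>I. creates (xs @ [i]) (length xs) a b
      then [card {c \<in> I. word_perm xs c \<le> i}] else [])"
proof -
  have "creates (xs @ [i]) k a b = creates xs k a b" if "k < length xs" for k a b
    using that by (simp add: creates_def)
  then have "concat (map (\<lambda>k. if \<exists>a\<in>I. \<exists>b\<in>I. creates (xs @ [i]) k a b
      then [card {c \<in> I. word_perm (take k (xs @ [i])) c \<le> (xs @ [i]) ! k}] else [])
      [0..<length xs]) = restrict_word I xs"
    unfolding restrict_word_def by (intro arg_cong[of _ _ concat] map_cong) (simp_all add: nth_append)
  then show ?thesis by (simp add: restrict_word_def[of I "xs @ [i]"])
qed

lemma creates_last:
  assumes u: "word_perm xs permutes {1..n}" and i: "0 < i" "i < n"
    and asc: "inv (word_perm xs) i < inv (word_perm xs) (i + 1)"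
  shows "creates (xs @ [i]) (length xs) a b \<longleftrightarrow>
    a = inv (word_perm xs) i \<and> b = inv (word_perm xs) (i + 1)"
proof -
  let ?u = "word_perm xs"
  have inv: "c = inv ?u d \<longleftrightarrow> ?u c = d" for c d using permutes_inv_eq[OF u, of d c] by metis
  have c: "creates (xs @ [i]) (length xs) a b \<longleftrightarrow>
    a < b \<and> transpose i (i + 1) (?u b) < transpose i (i + 1) (?u a) \<and> \<not> ?u b < ?u a"
    by (auto simp: creates_def is_inversion_def word_perm_snoc)
  show ?thesis
  proof
    assume cr: "creates (xs @ [i]) (length xs) a b"
    then have "?u a \<noteq> ?u b" using c permutes_inj[OF u] by (auto dest: injD)
    then have "?u a = i" "?u b = i + 1"
      using cr unfolding c by (auto simp: transpose_def split: if_splits)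
    then show "a = inv ?u i \<and> b = inv ?u (i + 1)" using inv by blast
  next
    assume ab: "a = inv ?u i \<and> b = inv ?u (i + 1)"
    then have "?u a = i" "?u b = i + 1" using inv by blast+
    then show "creates (xs @ [i]) (length xs) a b" unfolding c using ab asc by simp
  qed
qed

lemma length_keep_take_wires:
  assumes u: "u permutes {1..n}" and i: "i \<le> n" and I: "I \<subseteq> {1..n}"
  shows "length (keep I (take i (wires n u))) = card {c \<in> I. u c \<le> i}"
proof -
  have tk: "take i (wires n u) = map (inv u) [1..<Suc i]"
    using i by (simp add: wires_def take_map take_upt del: upt_Suc)
  have "length (keep I (take i (wires n u))) = card (set (keep I (take i (wires n u))))"
    using u by (intro distinct_card[symmetric]) simp
  also have "set (keep I (take i (wires n u))) = {c \<in> I. u c \<le> i}"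
    unfolding tk
  proof (intro set_eqI iffI)
    fix c assume "c \<in> set (keep I (map (inv u) [1..<Suc i]))"
    then show "c \<in> {c \<in> I. u c \<le> i}" using permutes_inverses(1)[OF u] by (auto simp del: upt_Suc)
  next
    fix c assume c: "c \<in> {c \<in> I. u c \<le> i}"
    then have "u c \<in> {1..n}" using I permutes_in_image[OF u] by blast
    then have "u c \<in> set [1..<Suc i]" using c by auto
    moreover have "c = inv u (u c)" using permutes_inverses(2)[OF u] by simp
    ultimately show "c \<in> set (keep I (map (inv u) [1..<Suc i]))" using c by (auto simp del: upt_Suc)
  qed
  finally show ?thesis .
qed

lemma restrict_word_eq:
  assumes I: "I \<subseteq> {1..n}" and "ascending [1..<Suc n] xs"
  shows "restrict_word I xs = restrict_wires I [1..<Suc n] xs"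
  using assms(2)
proof (induction xs rule: rev_induct)
  case Nil
  then show ?case by (simp add: restrict_word_def)
next
  case (snoc i xs)
  let ?L = "[1..<Suc n]" and ?u = "word_perm xs"
  have asc: "ascending ?L xs" and last: "ascending (apply_word ?L xs) [i]"
    using snoc.prems unfolding ascending_append by auto
  have s: "set xs \<subseteq> {1..<n}" using ascending_letters[OF asc] by (simp del: upt_Suc)
  have apply_word: "apply_word ?L xs = wires n ?u" by (rule apply_word_upt[OF s])
  have u: "?u permutes {1..n}" by (rule word_perm_permutes[OF s])
  have i: "0 < i" "i < n" using last unfolding apply_word by auto
  have n1: "wires n ?u ! (i - 1) = inv ?u i" "wires n ?u ! i = inv ?u (i + 1)"
    using wires_nth[of i n ?u] wires_nth[of "i + 1" n ?u] i by auto
  have "inv ?u i < inv ?u (i + 1)" using last unfolding apply_word using n1 by simp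
  note cr = creates_last[OF u i this]
  show ?case
    unfolding restrict_word_snoc restrict_wires_append apply_word cr snoc.IH[OF asc]
    using n1 length_keep_take_wires[OF u _ I, of i] i by simp
qed

lemma ascending_map:
  assumes "\<And>a b. a \<in> set L \<Longrightarrow> b \<in> set L \<Longrightarrow> f a < f b \<longleftrightarrow> a < b"
  shows "ascending (map f L) xs \<longleftrightarrow> ascending L xs"
    and "ascending L xs \<Longrightarrow> apply_word (map f L) xs = map f (apply_word L xs)"
proof -
  have "(ascending (map f L) xs \<longleftrightarrow> ascending L xs) \<and>
    (ascending L xs \<longrightarrow> apply_word (map f L) xs = map f (apply_word L xs))"
    using assms
  proof (induction xs arbitrary: L)
    case (Cons i xs)
    show ?case
    proof (cases "0 < i \<and> i < length L")
      case True
      then have "set (swap_at i L) = set L" "i - 1 < length L" by auto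
      with Cons.IH[of "swap_at i L"] Cons.prems True show ?thesis
        by (simp add: swap_at_map)
    qed auto
  qed simp
  then show "ascending (map f L) xs \<longleftrightarrow> ascending L xs"
    and "ascending L xs \<Longrightarrow> apply_word (map f L) xs = map f (apply_word L xs)" by auto
qed

lemma elem_at_less_iff:
  assumes "finite I" "i \<in> {1..card I}" "j \<in> {1..card I}"
  shows "elem_at I i < elem_at I j \<longleftrightarrow> i < j"
  using elem_at_strict_mono[OF assms(1)] assms(2,3) by (metis less_asym linorder_less_linear)

lemma elem_at_upt:
  assumes "I \<subseteq> {1..n}"
  shows "map (elem_at I) [1..<Suc (card I)] = keep I [1..<Suc n]"
proof (rule strict_sorted_equal)
  have fin: "finite I" using assms finite_subset by blast
  show "sorted_wrt (<) (map (elem_at I) [1..<Suc (card I)])"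
    unfolding sorted_wrt_map
    by (rule sorted_wrt_mono_rel[OF _ sorted_wrt_upt]) (auto simp: elem_at_less_iff[OF fin])
  show "sorted_wrt (<) (keep I [1..<Suc n])"
    by (intro sorted_wrt_filter sorted_wrt_upt)
  show "set (map (elem_at I) [1..<Suc (card I)]) = set (keep I [1..<Suc n])"
    using elem_at_bij[OF fin] assms
    by (auto simp: bij_betw_def atLeastLessThanSuc_atLeastAtMost simp del: upt_Suc)
qed

text \<open>
  Both lists contain the elements of \<open>I\<close> in the order of increasing values of \<open>w\<close>.
\<close>

lemma elem_at_wires:
  assumes w: "w permutes {1..n}" and I: "I \<subseteq> {1..n}"
  shows "map (elem_at I) (wires (card I) (pattern w I)) = keep I (wires n w)"
proof -
  let ?p = "pattern w I" and ?h = "card I"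
  have fin: "finite I" using I finite_subset by blast
  have p: "?p permutes {1..?h}" by (rule pattern_permutes[OF w I])
  have "map w (map (elem_at I) (wires ?h ?p)) = map w (keep I (wires n w))"
  proof (rule strict_sorted_equal)
    have "w (elem_at I (inv ?p i)) < w (elem_at I (inv ?p j))"
      if "i \<in> {1..?h}" "j \<in> {1..?h}" "i < j" for i j
    proof -
      have "inv ?p i \<in> {1..?h}" "inv ?p j \<in> {1..?h}"
        using that permutes_in_image[OF permutes_inv[OF p]] by blast+
      then show ?thesis
        using pattern_less_iff[OF w I] that(3) permutes_inverses(1)[OF p] by metis
    qed
    then show "sorted_wrt (<) (map w (map (elem_at I) (wires ?h ?p)))"
      unfolding wires_def sorted_wrt_map
      by (intro sorted_wrt_mono_rel[OF _ sorted_wrt_upt]) auto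
    have "sorted_wrt (\<lambda>a b. w a < w b) (wires n w)"
      unfolding wires_def sorted_wrt_map permutes_inverses(1)[OF w] by (rule sorted_wrt_upt)
    then show "sorted_wrt (<) (map w (keep I (wires n w)))"
      unfolding sorted_wrt_map by (rule sorted_wrt_filter)
    have "elem_at I ` {1..?h} = I" using elem_at_bij[OF fin] by (simp add: bij_betw_def)
    then have "set (map (elem_at I) (wires ?h ?p)) = set (keep I (wires n w))"
      using p w I by auto
    then show "set (map w (map (elem_at I) (wires ?h ?p))) = set (map w (keep I (wires n w)))"
      by (metis set_map)
  qed
  then show ?thesis using permutes_inj[OF w] inj_map_eq_map by blast
qed

text \<open>
  Relabelling the wires \<open>1, \<dots>, card I\<close> by the elements of \<open>I\<close> turns diagrams of the pattern into
  diagrams on the sublist of wires in \<open>I\<close>; the letters do not change.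
\<close>

lemma reduced_words_pattern_iff:
  assumes w: "w permutes {1..n}" and I: "I \<subseteq> {1..n}"
  shows "x \<in> reduced_words (card I) (pattern w I) \<longleftrightarrow>
    ascending (keep I [1..<Suc n]) x \<and> apply_word (keep I [1..<Suc n]) x = keep I (wires n w)"
proof -
  let ?p = "pattern w I" and ?h = "card I"
  let ?L = "[1..<Suc ?h]"
  have fin: "finite I" using I finite_subset by blast
  have p: "?p permutes {1..?h}" by (rule pattern_permutes[OF w I])
  have setL: "set ?L = {1..?h}" by (simp add: atLeastLessThanSuc_atLeastAtMost del: upt_Suc)
  have e: "elem_at I a < elem_at I b \<longleftrightarrow> a < b" if "a \<in> set ?L" "b \<in> set ?L" for a b
    using that unfolding setL by (rule elem_at_less_iff[OF fin])
  have inj: "inj_on (elem_at I) {1..?h}" using elem_at_bij[OF fin] by (simp add: bij_betw_def)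
  have "apply_word ?L x = wires ?h ?p \<longleftrightarrow> apply_word (keep I [1..<Suc n]) x = keep I (wires n w)"
    if asc: "ascending ?L x"
  proof -
    have "apply_word (keep I [1..<Suc n]) x = map (elem_at I) (apply_word ?L x)"
      unfolding elem_at_upt[OF I, symmetric] by (rule ascending_map(2)[OF e asc])
    moreover have "set (apply_word ?L x) \<union> set (wires ?h ?p) = {1..?h}"
      using set_apply_word[OF asc] setL p by simp
    then have "inj_on (elem_at I) (set (apply_word ?L x) \<union> set (wires ?h ?p))" using inj by simp
    ultimately show ?thesis
      unfolding elem_at_wires[OF w I, symmetric] using inj_on_map_eq_map by metis
  qed
  moreover have "ascending (keep I [1..<Suc n]) x \<longleftrightarrow> ascending ?L x"
    unfolding elem_at_upt[OF I, symmetric] by (rule ascending_map(1)[OF e])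
  ultimately show ?thesis unfolding reduced_words_iff[OF p] by blast
qed

section \<open>Minimal lifts of reduced words\<close>

lemma minimal_lift_properties:
  assumes w: "w permutes {1..n}" and I: "I \<subseteq> {1..n}"
    and x: "x \<in> reduced_words (card I) (pattern w I)"
  shows "minimal_lift n w I x \<in> reduced_words n w"
    and "restrict_word I (minimal_lift n w I x) = x"
    and "y \<in> reduced_words n w \<Longrightarrow> restrict_word I y = x \<Longrightarrow> minimal_lift n w I x \<le> y"
proof -
  let ?F = "{y. y \<in> reduced_words n w \<and> restrict_word I y = x}"
  obtain y where y: "ascending [1..<Suc n] y" "apply_word [1..<Suc n] y = wires n w"
    "restrict_wires I [1..<Suc n] y = x"
    using lift_to_wires[OF w] x[unfolded reduced_words_pattern_iff[OF w I]] by blast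
  then have yF: "y \<in> ?F" using reduced_words_iff[OF w] restrict_word_eq[OF I y(1)] by simp
  have fin: "finite ?F" using finite_reduced_words by simp
  have Min: "minimal_lift n w I x = Min ?F"
    unfolding minimal_lift_def using fin yF by (intro Least_Min) auto
  have "Min ?F \<in> ?F" using fin yF by (intro Min_in) auto
  then show "minimal_lift n w I x \<in> reduced_words n w" "restrict_word I (minimal_lift n w I x) = x"
    unfolding Min by auto
  show "minimal_lift n w I x \<le> y" if "y \<in> reduced_words n w" "restrict_word I y = x" for y
    unfolding Min using fin that by (intro Min_le) auto
qed

text \<open>
  The image consists of the reduced words that are least in their fibre. As every reduced word lies in
  the fibre over its own restriction, this condition is minimality as a lift.
\<close>

lemma minimal_lift_image:
  assumes w: "w permutes {1..n}" and I: "I \<subseteq> {1..n}"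
  shows "minimal_lift n w I ` reduced_words (card I) (pattern w I) =
    {y \<in> reduced_words n w. greedy I [1..<Suc n] y}"
proof -
  let ?L = "[1..<Suc n]"
  have greedy: "greedy I ?L y \<longleftrightarrow>
      (\<forall>z\<in>reduced_words n w. restrict_word I z = restrict_word I y \<longrightarrow> y \<le> z)"
    if y: "y \<in> reduced_words n w" for y
  proof -
    have asc: "ascending ?L y" "apply_word ?L y = wires n w" using y reduced_words_iff[OF w] by auto
    have "distinct ?L" by (rule distinct_upt)
    then have "greedy I ?L y \<longleftrightarrow> minimal I ?L y"
      using greedy_imp_minimal minimal_imp_greedy asc(1) by blast
    also have "\<dots> \<longleftrightarrow> (\<forall>z\<in>reduced_words n w. restrict_word I z = restrict_word I y \<longrightarrow> y \<le> z)"
      using restrict_word_eq[OF I] asc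
      unfolding minimal_def Ball_def reduced_words_iff[OF w] by (auto simp del: upt_Suc)
    finally show ?thesis .
  qed
  have res: "restrict_word I y \<in> reduced_words (card I) (pattern w I)"
    if y: "y \<in> reduced_words n w" for y
  proof -
    have asc: "ascending ?L y" "apply_word ?L y = wires n w" using y reduced_words_iff[OF w] by auto
    then show ?thesis
      unfolding reduced_words_pattern_iff[OF w I] restrict_word_eq[OF I asc(1)]
      using restrict_wires_correct[OF asc(1), of I] by simp
  qed
  note ml = minimal_lift_properties[OF w I]
  show ?thesis
  proof (intro equalityI subsetI)
    fix y assume "y \<in> minimal_lift n w I ` reduced_words (card I) (pattern w I)"
    then show "y \<in> {y \<in> reduced_words n w. greedy I ?L y}" using ml greedy by auto
  next
    fix y assume y: "y \<in> {y \<in> reduced_words n w. greedy I ?L y}"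
    then have x: "restrict_word I y \<in> reduced_words (card I) (pattern w I)" using res by simp
    have "minimal_lift n w I (restrict_word I y) = y"
      using y greedy ml[OF x] by (intro antisym) auto
    then show "y \<in> minimal_lift n w I ` reduced_words (card I) (pattern w I)" using x by force
  qed
qed

theorem theorem4p10:
  shows "inclusion_exclusion_structure reduced_words minimal_lift"
  unfolding inclusion_exclusion_structure_def
proof (intro allI impI conjI)
  fix n w I J assume w: "w permutes {1..n::nat}"
  show "finite (reduced_words n w)" by (rule finite_reduced_words)
  assume I: "I \<subseteq> {1..n}"
  show "minimal_lift n w I ` reduced_words (card I) (pattern w I) \<subseteq> reduced_words n w"
    using minimal_lift_properties(1)[OF w I] by blast
  show "inj_on (minimal_lift n w I) (reduced_words (card I) (pattern w I))"
    using minimal_lift_properties(2)[OF w I] by (rule inj_on_inverseI)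
  assume J: "J \<subseteq> {1..n}"
  have "greedy (I \<inter> J) [1..<Suc n] y \<longleftrightarrow> greedy I [1..<Suc n] y \<and> greedy J [1..<Suc n] y"
    if "y \<in> reduced_words n w" for y
  proof -
    have "ascending [1..<Suc n] y" using that reduced_words_iff[OF w] by blast
    then show ?thesis
      using greedy_Int[OF _ distinct_upt] greedy_mono[of "I \<inter> J"] by blast
  qed
  moreover have "I \<inter> J \<subseteq> {1..n}" using I by blast
  ultimately show "minimal_lift n w (I \<inter> J) ` reduced_words (card (I \<inter> J)) (pattern w (I \<inter> J)) =
    minimal_lift n w I ` reduced_words (card I) (pattern w I) \<inter>
    minimal_lift n w J ` reduced_words (card J) (pattern w J)"
    using minimal_lift_image[OF w] I J by auto
qed

end
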